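(* For any integers $m \ge 1$ and $n \ge 1$, the sum of the $m$-th powers $S_m(n) = \sum_{j=1}^{n} j^m$ can be evaluated exclusively through the integer coefficients $T(m,k)$: the numbers $T(m,k)$, $1 \le k \le m$, are integers and $$S_m(n) = \sum_{k=1}^{m} \frac{T(m, k)}{k+1}\, I_{k+1}(n),$$ where $T(m,k)$ are the entries of the normalized flickering central finite differences triangle and $I_{k+1}(n)$ are the integral flickering basis elements.
   Context: Normalized flickering central finite differences triangle: for integers $n \ge 1$ and $1 \le k \le n$, $T(n,k) = \frac{1}{k!}\,\delta^k f_i$, where $f(j) = j^n$ and $\delta^k f_i$ is the $k$-th order central finite difference (unit step) centered at $i$, with $i = 1/2$ if $k$ is odd and $i = 0$ if $k$ is even. Explicitly, $$T(n,k) = \frac{1}{k!}\sum_{r=0}^{k} (-1)^{k-r}\binom{k}{r}\,\bigl(r - \lfloor k/2\rfloor\bigr)^n .$$ The first rows are $(1)$; $(1,1)$; $(1,0,1)$; $(1,1,2,1)$; $(1,0,5,0,1)$; $(1,1,10,5,3,1)$. Integral flickering basis: for an integer $k \ge 1$, $$I_k(n) = \prod_{r=0}^{k-1}\bigl(n - \lfloor (k-1)/2\rfloor + r\bigr),$$ so $I_1(n)=n$, $I_2(n)=n(n+1)$, $I_3(n)=n(n+1)(n-1)$, $I_4(n)=n(n+1)(n-1)(n+2)$, $I_5(n)=n(n+1)(n-1)(n+2)(n-2)$, and so on. *)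

theory Defs
  imports Complex_Main
begin

definition central_diff :: "(real \<Rightarrow> real) \<Rightarrow> real \<Rightarrow> real" where
  "central_diff f x = f (x + 1/2) - f (x - 1/2)"

definition flicker_T :: "nat \<Rightarrow> nat \<Rightarrow> real" where
  "flicker_T n k =
     (central_diff ^^ k) (\<lambda>x. x ^ n) (if odd k then 1/2 else 0) / fact k"

text \<open>The index \<open>k\<close> is meant to be at least 1, so the subtraction on
  the naturals does not truncate and \<open>(k - 1) div 2\<close> is the floor of \<open>(k - 1) / 2\<close>.\<close>
definition flicker_I :: "nat \<Rightarrow> int \<Rightarrow> int" where
  "flicker_I k n = (\<Prod>r<k. n - int ((k - 1) div 2) + int r)"

definition power_sum :: "nat \<Rightarrow> nat \<Rightarrow> nat" where
  "power_sum m n = (\<Sum>j=1..n. j ^ m)"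

lemma central_diff_iterate:
  "(central_diff ^^ k) f x =
     (\<Sum>r\<le>k. (-1) ^ (k - r) * real (k choose r) * f (x - real k / 2 + real r))"
proof (induction k arbitrary: x)
  case 0
  then show ?case by simp
next
  case (Suc k)
  define g where "g r = f (x - real (Suc k) / 2 + real r)" for r
  have A: "(central_diff ^^ k) f (x + 1/2) =
      (\<Sum>r\<le>k. (-1) ^ (k - r) * real (k choose r) * g (Suc r))"
    unfolding Suc.IH g_def
    by (intro sum.cong refl arg_cong2[where f="(*)"] arg_cong[where f=f]) (simp add: field_simps)
  have B: "(central_diff ^^ k) f (x - 1/2) =
      (\<Sum>r\<le>k. (-1) ^ (k - r) * real (k choose r) * g r)"
    unfolding Suc.IH g_def
    by (intro sum.cong refl arg_cong2[where f="(*)"] arg_cong[where f=f]) (simp add: field_simps)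
  have C: "(\<Sum>r\<le>k. (-1) ^ (k - r) * real (k choose r) * g r) =
      - (\<Sum>r\<le>Suc k. (-1) ^ (Suc k - r) * real (k choose r) * g r)"
    by (simp add: Suc_diff_le sum_negf)
  have D: "(central_diff ^^ Suc k) f x =
      (central_diff ^^ k) f (x + 1/2) - (central_diff ^^ k) f (x - 1/2)"
    by (simp add: central_diff_def[of "(central_diff ^^ k) f"])
  have "(\<Sum>r\<le>Suc k. (-1) ^ (Suc k - r) * real (Suc k choose r) * g r) =
      (-1) ^ Suc k * g 0 + (\<Sum>r\<le>k. (-1) ^ (k - r) * real (Suc k choose Suc r) * g (Suc r))"
    by (simp add: sum.atMost_Suc_shift del: sum.atMost_Suc binomial_Suc_Suc)
  also have "\<dots> = (\<Sum>r\<le>k. (-1) ^ (k - r) * real (k choose r) * g (Suc r)) +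
      ((-1) ^ Suc k * g 0 + (\<Sum>r\<le>k. (-1) ^ (k - r) * real (k choose Suc r) * g (Suc r)))"
    by (simp add: sum.distrib algebra_simps)
  also have "(-1) ^ Suc k * g 0 + (\<Sum>r\<le>k. (-1) ^ (k - r) * real (k choose Suc r) * g (Suc r)) =
      (\<Sum>r\<le>Suc k. (-1) ^ (Suc k - r) * real (k choose r) * g r)"
    by (simp add: sum.atMost_Suc_shift del: sum.atMost_Suc)
  finally show ?case
    using A B C D unfolding g_def by linarith
qed

lemma flicker_T_explicit:
  "flicker_T n k =
     (\<Sum>r\<le>k. (-1) ^ (k - r) * real (k choose r) * (real r - real (k div 2)) ^ n) / fact k"
proof -
  have "(if odd k then 1/2 else 0) - real k / 2 + real r = real r - real (k div 2)" for r
    by (cases "even k") (auto elim!: evenE oddE simp: field_simps)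
  then show ?thesis
    unfolding flicker_T_def central_diff_iterate by simp
qed

end

(* The products B k x = (x - k div 2) ... (x - k div 2 + k - 1) form a Newton basis whose
   nodes are those of the k-th central difference, so that x ^ m = sum_k T(m, k) B k x; this
   reduces to a recurrence T(m + 1, k) = T(m, k - 1) + c k T(m, k) with c k an integer, which
   also gives integrality. Since I (k + 1) x - I (k + 1) (x - 1) = (k + 1) B k x, summing
   over x = 1, ..., n telescopes. *)
theory Submission
  imports Defs
begin

text \<open>Polymorphic in the ring because it is used twice: over the integers, where it contains
  the common factors of shifted \<open>flicker_I\<close> products, and over the reals, where powers
  are expanded in it.\<close>

definition flicker_basis :: "nat \<Rightarrow> 'a :: comm_ring_1 \<Rightarrow> 'a" where
  "flicker_basis k x = (\<Prod>r<k. x - of_nat (k div 2) + of_nat r)"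

text \<open>The node that the \<open>k\<close>-th central difference has in addition to those of the
  previous one: nodes are added alternately on the right and on the left.\<close>
definition flicker_node :: "nat \<Rightarrow> 'a :: comm_ring_1" where
  "flicker_node k = (if even k then - of_nat (k div 2) else of_nat (Suc k div 2))"

text \<open>For even \<open>k\<close> the offset \<open>k div 2\<close> does not change and the new
  factor is the last one; for odd \<open>k\<close> it grows by one and the new factor is the first
  one.\<close>

lemma flicker_basis_Suc:
  "flicker_basis (Suc k) x = (x - flicker_node k) * flicker_basis k (x :: 'a :: comm_ring_1)"
proof (cases "even k")
  case True
  then obtain p where "k = 2 * p" by (elim evenE)
  then show ?thesis
    by (simp add: flicker_basis_def flicker_node_def algebra_simps)
next
  case False
  then obtain p where k: "k = 2 * p + 1" by (elim oddE)
  show ?thesis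
    unfolding flicker_basis_def prod.lessThan_Suc_shift
    by (simp add: k flicker_node_def algebra_simps del: prod.lessThan_Suc)
qed

lemma flicker_T_0: "flicker_T m 0 = 0 ^ m"
  by (simp add: flicker_T_explicit)

lemma flicker_T_0_left: "flicker_T 0 k = (if k = 0 then 1 else 0)"
proof (cases "k = 0")
  case False
  have "(\<Sum>r\<le>k. (-1) ^ (k - r) * real (k choose r)) = (1 + (-1)) ^ k"
    unfolding binomial_ring by (simp add: mult.commute)
  with False show ?thesis
    by (simp add: flicker_T_explicit power_0_left)
qed (simp add: flicker_T_0)

lemma flicker_T_Suc_Suc:
  "flicker_T (Suc m) (Suc j) = flicker_T m j + flicker_node (Suc j) * flicker_T m (Suc j)"
proof -
  define x where "x r = real r - real (Suc j div 2)" for r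
  \<comment> \<open>The node is the leftmost sample point \<open>x 0\<close> when
    \<open>Suc j\<close> is even and the rightmost \<open>x (Suc j)\<close> when it is odd. The
    weight \<open>x r - flicker_node (Suc j)\<close> kills that end term, and the absorption
    identity for binomials turns the others into the sum of order \<open>j\<close>.\<close>
  have "(\<Sum>r\<le>Suc j. (-1) ^ (Suc j - r) * real (Suc j choose r) * x r ^ m * (x r - flicker_node (Suc j)))
     = real (Suc j) * (\<Sum>r\<le>j. (-1) ^ (j - r) * real (j choose r) * (real r - real (j div 2)) ^ m)"
  proof (cases "even (Suc j)")
    case True
    have node: "x r - flicker_node (Suc j) = real r" for r
      using True by (simp add: x_def flicker_node_def)
    have shift: "x (Suc r) = real r - real (j div 2)" for r
      using True by (auto simp: x_def elim!: oddE)
    have absorb: "real (Suc j choose Suc r) * real (Suc r) = real (Suc j) * real (j choose r)" for r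
      by (metis Suc_times_binomial mult.commute of_nat_mult)
    have regroup: "s * a * y * b = c * (s * d * y)" if "a * b = c * d" for s a y b c d :: real
      using that by algebra
    have summand: "(-1) ^ (Suc j - Suc r) * real (Suc j choose Suc r) * x (Suc r) ^ m * real (Suc r)
        = real (Suc j) * ((-1) ^ (j - r) * real (j choose r) * (real r - real (j div 2)) ^ m)" for r
      unfolding shift diff_Suc_Suc by (rule regroup[OF absorb])
    show ?thesis
      unfolding node sum.atMost_Suc_shift summand sum_distrib_left by simp
  next
    case False
    have node: "x r - flicker_node (Suc j) = real r - real (Suc j)" for r
      using False by (auto simp: x_def flicker_node_def elim!: evenE)
    have x: "x r = real r - real (j div 2)" for r
      using False by (auto simp: x_def)
    have regroup: "- s * a * y * (b - c) = c * (s * d * y)" if "(c - b) * a = c * d" for s a y b c d :: real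
      using that by algebra
    have summand: "(-1) ^ (Suc j - r) * real (Suc j choose r) * x r ^ m * (real r - real (Suc j))
        = real (Suc j) * ((-1) ^ (j - r) * real (j choose r) * (real r - real (j div 2)) ^ m)"
      if "r \<le> j" for r
    proof -
      have "real (Suc j - r) * real (Suc j choose r) = real (Suc j) * real (j choose r)"
        by (metis binomial_absorb_comp diff_Suc_1 of_nat_mult)
      then have absorb: "(real (Suc j) - real r) * real (Suc j choose r) = real (Suc j) * real (j choose r)"
        using that by (simp add: of_nat_diff)
      have sign: "(-1) ^ (Suc j - r) = - ((-1) ^ (j - r) :: real)"
        using that by (simp add: Suc_diff_le)
      show ?thesis
        unfolding x sign by (rule regroup[OF absorb])
    qed
    show ?thesis
      unfolding node sum.atMost_Suc sum_distrib_left using summand by simp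
  qed
  \<comment> \<open>Split one factor of \<open>x r ^ Suc m\<close> as \<open>(x r - c) + c\<close>
    with \<open>c\<close> the node.\<close>
  then have "(\<Sum>r\<le>Suc j. (-1) ^ (Suc j - r) * real (Suc j choose r) * x r ^ Suc m)
     = real (Suc j) * (\<Sum>r\<le>j. (-1) ^ (j - r) * real (j choose r) * (real r - real (j div 2)) ^ m)
       + flicker_node (Suc j) * (\<Sum>r\<le>Suc j. (-1) ^ (Suc j - r) * real (Suc j choose r) * x r ^ m)"
    by (simp add: right_diff_distrib sum_subtractf sum_distrib_left algebra_simps
        del: sum.atMost_Suc binomial_Suc_Suc of_nat_Suc)
  then show ?thesis
    unfolding flicker_T_explicit x_def
    by (simp add: add_divide_distrib del: sum.atMost_Suc binomial_Suc_Suc of_nat_Suc power_Suc)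
qed

lemma flicker_T_eq_0: "m < k \<Longrightarrow> flicker_T m k = 0"
proof (induction m arbitrary: k)
  case (Suc m)
  then show ?case by (cases k) (simp_all add: flicker_T_Suc_Suc)
qed (simp add: flicker_T_0_left)

text \<open>The nodes are integers, so the recurrence never leaves the integers, despite the
  division by \<open>fact k\<close> in the definition.\<close>

lemma flicker_T_Ints: "flicker_T m k \<in> \<int>"
proof (induction m arbitrary: k)
  case (Suc m)
  then show ?case
    by (cases k) (simp_all add: flicker_T_0 flicker_T_Suc_Suc flicker_node_def)
qed (simp add: flicker_T_0_left)

text \<open>Multiplying the \<open>k\<close>-th basis element by \<open>x\<close> gives the next one
  plus \<open>flicker_node k\<close> times itself; collecting coefficients reproduces the recurrence
  of \<open>flicker_T\<close>.\<close>

lemma power_eq_sum_flicker_basis: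
  "x ^ m = (\<Sum>k\<le>m. flicker_T m k * flicker_basis k x)"
proof (induction m)
  case 0
  then show ?case by (simp add: flicker_T_0 flicker_basis_def)
next
  case (Suc m)
  let ?S = "\<Sum>k\<le>m. flicker_T m k * flicker_node k * flicker_basis k x"
  have "x ^ Suc m = (\<Sum>k\<le>m. flicker_T m k * flicker_basis (Suc k) x) + ?S"
    unfolding power_Suc Suc.IH sum_distrib_left sum.distrib[symmetric]
    by (intro sum.cong refl) (simp add: flicker_basis_Suc algebra_simps)
  also have "?S = (\<Sum>k\<le>Suc m. flicker_T m k * flicker_node k * flicker_basis k x)"
    by (simp add: flicker_T_eq_0)
  \<comment> \<open>The term at \<open>k = 0\<close> drops out because
    \<open>flicker_node 0 = 0\<close>.\<close>
  also have "\<dots> = (\<Sum>k\<le>m. flicker_T m (Suc k) * flicker_node (Suc k) * flicker_basis (Suc k) x)"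
    by (subst sum.atMost_Suc_shift) (simp add: flicker_node_def)
  also have "(\<Sum>k\<le>m. flicker_T m k * flicker_basis (Suc k) x) + \<dots>
      = (\<Sum>k\<le>m. flicker_T (Suc m) (Suc k) * flicker_basis (Suc k) x)"
    by (simp add: flicker_T_Suc_Suc sum.distrib[symmetric] algebra_simps)
  also have "\<dots> = (\<Sum>k\<le>Suc m. flicker_T (Suc m) k * flicker_basis k x)"
    by (subst sum.atMost_Suc_shift) (simp add: flicker_T_0)
  finally show ?case .
qed

text \<open>Both products contain \<open>flicker_basis k n\<close>; their remaining end factors
  differ by \<open>k + 1\<close>.\<close>

lemma flicker_I_diff:
  "flicker_I (Suc k) n - flicker_I (Suc k) (n - 1) = int (Suc k) * flicker_basis k n"
proof -
  have "flicker_I (Suc k) n = flicker_basis k n * (n - int (k div 2) + int k)"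
    by (simp add: flicker_I_def flicker_basis_def)
  moreover have "flicker_I (Suc k) (n - 1) = (n - 1 - int (k div 2)) * flicker_basis k n"
    unfolding flicker_I_def flicker_basis_def prod.lessThan_Suc_shift
    by (simp add: algebra_simps del: prod.lessThan_Suc)
  ultimately show ?thesis by (simp add: algebra_simps)
qed

text \<open>The factor at \<open>r = k div 2\<close> vanishes, so the telescoping sum starts from
  zero.\<close>

lemma flicker_I_0: "flicker_I (Suc k) 0 = 0"
  by (auto simp: flicker_I_def simp del: prod.lessThan_Suc intro!: bexI[of _ "k div 2"])

lemma flicker_I_Suc_eq_sum:
  "flicker_I (Suc k) (int n) = int (Suc k) * (\<Sum>j=1..n. flicker_basis k (int j))"
proof (induction n)
  case (Suc n)
  then show ?case
    using flicker_I_diff[of k "int (Suc n)"] by (simp add: algebra_simps)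
qed (simp add: flicker_I_0)

lemma of_int_flicker_basis: "of_int (flicker_basis k n) = flicker_basis k (of_int n)"
  by (simp add: flicker_basis_def)

theorem theorem1:
  fixes m n :: nat
  assumes "m \<ge> 1" and "n \<ge> 1"
  shows "(\<forall>k\<in>{1..m}. flicker_T m k \<in> \<int>) \<and>
    real (power_sum m n) =
      (\<Sum>k=1..m. flicker_T m k / real (k + 1) * real_of_int (flicker_I (k + 1) (int n)))"
proof
  show "\<forall>k\<in>{1..m}. flicker_T m k \<in> \<int>"
    by (simp add: flicker_T_Ints)
  have I: "real_of_int (flicker_I (k + 1) (int n)) = real (k + 1) * (\<Sum>j=1..n. flicker_basis k (real j))" for k
    by (simp add: flicker_I_Suc_eq_sum of_int_flicker_basis)
  \<comment> \<open>Since \<open>m\<close> is positive, \<open>flicker_T m 0 = 0 ^ m\<close>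
    vanishes and the sum may start at 1.\<close>
  have pow: "real j ^ m = (\<Sum>k=1..m. flicker_T m k * flicker_basis k (real j))" for j
    using assms(1)
    by (subst power_eq_sum_flicker_basis, intro sum.mono_neutral_right)
       (auto simp: flicker_T_0 not_le)
  have "real (power_sum m n) = (\<Sum>k=1..m. \<Sum>j=1..n. flicker_T m k * flicker_basis k (real j))"
    unfolding power_sum_def of_nat_sum of_nat_power pow by (rule sum.swap)
  also have "\<dots> = (\<Sum>k=1..m. flicker_T m k / real (k + 1) * real_of_int (flicker_I (k + 1) (int n)))"
    unfolding I sum_distrib_left by (intro sum.cong refl) (simp add: field_simps)
  finally show "real (power_sum m n) =
      (\<Sum>k=1..m. flicker_T m k / real (k + 1) * real_of_int (flicker_I (k + 1) (int n)))" .
qed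

end
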